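(* Let $Z$ be a reflexive separable Banach space, let $\mathcal{E}\subset Z$ be weakly sequentially closed, and let $\mathcal{D},\bar{\mathcal{D}}\subset Z$ and $\mathcal{D}_h\subset Z$ ($h\in\mathbb{N}$). Suppose: (i) (Data convergence) $\bar{\mathcal{D}}\times\mathcal{E}=K(\Delta)\text{-}\lim_{h\to\infty}(\mathcal{D}\times\mathcal{E})$ (limit of the constant sequence). (ii) (Fine approximation) There is a sequence $\rho_h\downarrow0$ such that $d(\xi,\mathcal{D}_h)<\rho_h$ for all $\xi\in\mathcal{D}$. (iii) (Uniform approximation) There is a sequence $t_h\downarrow0$ such that $d(\xi,\mathcal{D})<t_h$ for all $\xi\in\mathcal{D}_h$. (iv) (Transversality) There are constants $c>0$ and $b\ge0$ such that $\|y-z\|\ge c(\|y\|+\|z\|)-b$ for all $y\in\mathcal{D}$ and $z\in\mathcal{E}$. Then $\bar{\mathcal{D}}\times\mathcal{E}=K(\Delta)\text{-}\lim_{h\to\infty}(\mathcal{D}_h\times\mathcal{E})$.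
   Context: $d(z,A)=\inf\{\|z-a\|:a\in A\}$. $I_A$ is the indicator function of a set $A$: $0$ on $A$ and $\infty$ elsewhere. Data topology $\Delta$ on $Z\times Z$: the coarsest topology for which all sets $(A\times A')\cap\{(z,z'):z-z'\in C\}$ are open, with $A,A'\subset Z$ weakly open and $C\subset Z$ strongly open. A sequence $(y_h,z_h)$ is said to converge to $(y,z)$ in this sense if $y_h\rightharpoonup y$, $z_h\rightharpoonup z$ weakly and $y_h-z_h\to y-z$ strongly. Kuratowski limit: for subsets $S,S_h$ of $Z\times Z$, $S=K(\Delta)\text{-}\lim_{h\to\infty}S_h$ means that the indicator functions $I_{S_h}$ $\Gamma$-converge to $I_S$ with respect to $\Delta$, i.e. for all $p\in Z\times Z$ $$I_S(p)=\sup_{U\in\mathcal{N}(p)}\liminf_{h\to\infty}\inf_{q\in U}I_{S_h}(q)=\sup_{U\in\mathcal{N}(p)}\limsup_{h\to\infty}\inf_{q\in U}I_{S_h}(q),$$ where $\mathcal{N}(p)$ is the family of all $\Delta$-open sets containing $p$. *)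

theory Defs
  imports "HOL-Analysis.Analysis"
begin

(* Scalars are real. Surjectivity of the canonical map into the bidual is written out
   pointwise: every bounded functional on the dual is evaluation at some point. *)
definition reflexive_space :: "'z::real_normed_vector itself \<Rightarrow> bool" where
  "reflexive_space _ \<longleftrightarrow>
     (\<forall>\<Phi> :: ('z \<Rightarrow>\<^sub>L real) \<Rightarrow>\<^sub>L real. \<exists>x::'z. \<forall>f :: 'z \<Rightarrow>\<^sub>L real.
        blinfun_apply \<Phi> f = blinfun_apply f x)"

definition weak_topology :: "'z::real_normed_vector topology" where
  "weak_topology =
     topology_generated_by {blinfun_apply f -` U | (f :: 'z \<Rightarrow>\<^sub>L real) U. open U}"

definition weakly_sequentially_closed :: "'z::real_normed_vector set \<Rightarrow> bool" where
  "weakly_sequentially_closed E \<longleftrightarrow>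
     (\<forall>x l. (\<forall>n::nat. x n \<in> E) \<and> limitin weak_topology x l sequentially \<longrightarrow> l \<in> E)"

definition data_topology :: "('z::real_normed_vector \<times> 'z) topology" where
  "data_topology = topology_generated_by
     {(A \<times> A') \<inter> {(z, z'). z - z' \<in> C} | A A' C.
        openin weak_topology A \<and> openin weak_topology A' \<and> open C}"

(* Unlike the library's infdist and setdist, which return 0 for the empty set,
   this is infinite when A is empty. *)
definition dist_to_set :: "'z::real_normed_vector \<Rightarrow> 'z set \<Rightarrow> ereal" where
  "dist_to_set z A = (INF a\<in>A. ereal (norm (z - a)))"

(* The indicator function of convex analysis, not the 0/1-valued one of the library. *)
definition indicator_inf :: "'a set \<Rightarrow> 'a \<Rightarrow> ereal" where
  "indicator_inf A x = (if x \<in> A then 0 else \<infinity>)"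

definition gamma_liminf :: "'a topology \<Rightarrow> (nat \<Rightarrow> 'a \<Rightarrow> ereal) \<Rightarrow> 'a \<Rightarrow> ereal" where
  "gamma_liminf T F p =
     (SUP U\<in>{U. openin T U \<and> p \<in> U}. liminf (\<lambda>h. INF q\<in>U. F h q))"

definition gamma_limsup :: "'a topology \<Rightarrow> (nat \<Rightarrow> 'a \<Rightarrow> ereal) \<Rightarrow> 'a \<Rightarrow> ereal" where
  "gamma_limsup T F p =
     (SUP U\<in>{U. openin T U \<and> p \<in> U}. limsup (\<lambda>h. INF q\<in>U. F h q))"

definition gamma_converges ::
  "'a topology \<Rightarrow> (nat \<Rightarrow> 'a \<Rightarrow> ereal) \<Rightarrow> ('a \<Rightarrow> ereal) \<Rightarrow> bool" where
  "gamma_converges T F f \<longleftrightarrow>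
     (\<forall>p\<in>topspace T. f p = gamma_liminf T F p \<and> f p = gamma_limsup T F p)"

definition kuratowski_limit :: "'a topology \<Rightarrow> (nat \<Rightarrow> 'a set) \<Rightarrow> 'a set \<Rightarrow> bool" where
  "kuratowski_limit T S_seq S \<longleftrightarrow>
     gamma_converges T (\<lambda>h. indicator_inf (S_seq h)) (indicator_inf S)"

lemma topspace_weak_topology [simp]:
  "topspace (weak_topology :: 'z::real_normed_vector topology) = UNIV"
proof -
  have "(UNIV :: 'z set) \<in> {blinfun_apply f -` U | (f :: 'z \<Rightarrow>\<^sub>L real) U. open U}"
    by (rule CollectI, rule exI[of _ 0], rule exI[of _ UNIV]) simp
  from Union_upper[OF this] show ?thesis
    unfolding weak_topology_def topology_generated_by_topspace by (rule top.extremum_uniqueI)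
qed

lemma topspace_data_topology [simp]:
  "topspace (data_topology :: ('z::real_normed_vector \<times> 'z) topology) = UNIV"
proof -
  have w: "openin (weak_topology :: 'z topology) UNIV"
    using openin_topspace[of "weak_topology :: 'z topology"]
    unfolding topspace_weak_topology .
  have "(UNIV :: ('z \<times> 'z) set) \<in> {(A \<times> A') \<inter> {(z, z'). z - z' \<in> C} | A A' C.
      openin weak_topology A \<and> openin weak_topology A' \<and> open C}"
    by (rule CollectI, rule exI[of _ UNIV], rule exI[of _ UNIV], rule exI[of _ UNIV])
       (simp add: w)
  from Union_upper[OF this] show ?thesis
    unfolding data_topology_def topology_generated_by_topspace by (rule top.extremum_uniqueI)
qed

end

theory Submission
  imports Defs
begin

text \<open>
  Convergence of sets in the sense of Kuratowski only asks which neighbourhoods of a point are met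
  by the sets, frequently or eventually (\<open>kuratowski_limit_iff_meets\<close>). For the constant
  sequence both conditions say that the point lies in the closure of \<open>D \<times> E\<close>. So the task is to
  compare the neighbourhoods met by \<open>Dh h \<times> E\<close> with those met by \<open>D \<times> E\<close>.

  By fine and uniform approximation, a point of one of the two products can be moved into the other
  one by a displacement of its first component whose norm is smaller than a null sequence. The data
  topology is a vector space topology coarser than the norm topology, and therefore tolerates
  such displacements uniformly: inside every neighbourhood \<open>U\<close> of a point there is a
  smaller one \<open>V\<close> such that all points of \<open>V\<close> stay in \<open>U\<close> when their first component is displaced
  by less than some \<open>\<delta>\<close> (\<open>data_topology_absorbs_shifts\<close>). Hence if \<open>D \<times> E\<close> meets \<open>V\<close>, then
  \<open>Dh h \<times> E\<close> meets \<open>U\<close> for all large \<open>h\<close>; and if \<open>Dh h \<times> E\<close> meets \<open>V\<close> for infinitely many \<open>h\<close>,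
  then \<open>D \<times> E\<close> meets \<open>U\<close>.
\<close>

section \<open>Kuratowski limits in terms of neighbourhoods\<close>

lemma INF_indicator_inf:
  "(INF q\<in>U. indicator_inf S q) = (if S \<inter> U = {} then \<infinity> else 0)"
proof (cases "S \<inter> U = {}")
  case True
  then have "(INF q\<in>U. indicator_inf S q) = (INF q\<in>U. \<infinity>)"
    by (intro INF_cong) (auto simp: indicator_inf_def)
  also have "\<dots> = \<infinity>"
    by (simp add: INF_eq_const top_ereal_def image_constant_conv)
  finally show ?thesis using True by simp
next
  case False
  then obtain q where "q \<in> U" "q \<in> S" by blast
  then have "(INF q\<in>U. indicator_inf S q) \<le> 0"
    by (intro INF_lower2[of q]) (auto simp: indicator_inf_def)
  moreover have "0 \<le> (INF q\<in>U. indicator_inf S q)"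
    by (intro INF_greatest) (simp add: indicator_inf_def)
  ultimately show ?thesis using False by simp
qed

lemma liminf_zero_infinity:
  fixes P :: "nat \<Rightarrow> bool"
  shows "liminf (\<lambda>h. if P h then \<infinity> else 0 :: ereal) =
    (if eventually P sequentially then \<infinity> else 0)"
proof (cases "eventually P sequentially")
  case True
  then have "liminf (\<lambda>h. if P h then \<infinity> else 0 :: ereal) = liminf (\<lambda>_. \<infinity>)"
    by (intro Liminf_eq) (auto elim: eventually_mono)
  then show ?thesis using True by (simp add: Liminf_const)
next
  case False
  have "\<not> 0 < liminf (\<lambda>h. if P h then \<infinity> else 0 :: ereal)"
  proof
    assume "0 < liminf (\<lambda>h. if P h then \<infinity> else 0 :: ereal)"
    then have "\<forall>\<^sub>F h in sequentially. 0 < (if P h then \<infinity> else 0 :: ereal)"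
      by (rule less_LiminfD)
    then have "eventually P sequentially"
      by (rule eventually_mono) (simp split: if_splits)
    with False show False by contradiction
  qed
  moreover have "0 \<le> liminf (\<lambda>h. if P h then \<infinity> else 0 :: ereal)"
    by (intro Liminf_bounded always_eventually) simp
  ultimately show ?thesis using False by simp
qed

lemma limsup_zero_infinity:
  fixes P :: "nat \<Rightarrow> bool"
  shows "limsup (\<lambda>h. if P h then \<infinity> else 0 :: ereal) =
    (if frequently P sequentially then \<infinity> else 0)"
proof (cases "frequently P sequentially")
  case True
  have "\<not> limsup (\<lambda>h. if P h then \<infinity> else 0 :: ereal) < \<infinity>"
  proof
    assume "limsup (\<lambda>h. if P h then \<infinity> else 0 :: ereal) < \<infinity>"
    then have "\<forall>\<^sub>F h in sequentially. (if P h then \<infinity> else 0 :: ereal) < \<infinity>"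
      by (rule Limsup_lessD)
    then have "\<forall>\<^sub>F h in sequentially. \<not> P h"
      by (rule eventually_mono) (simp split: if_splits)
    with True show False by (simp add: frequently_def)
  qed
  then show ?thesis using True by simp
next
  case False
  then have "limsup (\<lambda>h. if P h then \<infinity> else 0 :: ereal) = limsup (\<lambda>_. 0)"
    by (intro Limsup_eq) (auto simp: not_frequently elim: eventually_mono)
  then show ?thesis using False by (simp add: Limsup_const)
qed

lemma SUP_zero_infinity:
  assumes "I \<noteq> {}"
  shows "(SUP i\<in>I. if P i then \<infinity> else 0 :: ereal) = (if \<exists>i\<in>I. P i then \<infinity> else 0)"
proof (cases "\<exists>i\<in>I. P i")
  case True
  then obtain i where "i \<in> I" "P i" by blast
  then have "\<infinity> \<le> (SUP i\<in>I. if P i then \<infinity> else 0 :: ereal)"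
    by (intro SUP_upper2[of i]) auto
  then show ?thesis using True by simp
next
  case False
  then have "(SUP i\<in>I. if P i then \<infinity> else 0 :: ereal) = (SUP i\<in>I. 0)"
    by (intro SUP_cong) auto
  then show ?thesis using False assms by simp
qed

text \<open>
  All infima in the definition of the \<open>\<Gamma>\<close>-limit of indicator functions are \<open>0\<close> or \<open>\<infinity>\<close>, according
  to whether a neighbourhood meets the set or not. An inferior limit of such values is \<open>0\<close> iff they
  vanish frequently, and a superior limit is \<open>0\<close> iff they vanish eventually.
\<close>
lemma kuratowski_limit_iff_meets:
  "kuratowski_limit T S L \<longleftrightarrow>
    (\<forall>p\<in>topspace T.
      (p \<in> L \<longleftrightarrow> (\<forall>U. openin T U \<and> p \<in> U \<longrightarrow> (\<exists>\<^sub>F h in sequentially. S h \<inter> U \<noteq> {}))) \<and>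
      (p \<in> L \<longleftrightarrow> (\<forall>U. openin T U \<and> p \<in> U \<longrightarrow> (\<forall>\<^sub>F h in sequentially. S h \<inter> U \<noteq> {}))))"
proof -
  have "(indicator_inf L p = gamma_liminf T (\<lambda>h. indicator_inf (S h)) p \<and>
      indicator_inf L p = gamma_limsup T (\<lambda>h. indicator_inf (S h)) p) \<longleftrightarrow>
      (p \<in> L \<longleftrightarrow> (\<forall>U. openin T U \<and> p \<in> U \<longrightarrow> (\<exists>\<^sub>F h in sequentially. S h \<inter> U \<noteq> {}))) \<and>
      (p \<in> L \<longleftrightarrow> (\<forall>U. openin T U \<and> p \<in> U \<longrightarrow> (\<forall>\<^sub>F h in sequentially. S h \<inter> U \<noteq> {})))"
    if "p \<in> topspace T" for p
  proof -
    from that have "{U. openin T U \<and> p \<in> U} \<noteq> {}" by blast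
    note SUP_nhds = SUP_zero_infinity[OF this]
    have
      "gamma_liminf T (\<lambda>h. indicator_inf (S h)) p =
        (if \<exists>U. openin T U \<and> p \<in> U \<and> (\<forall>\<^sub>F h in sequentially. S h \<inter> U = {}) then \<infinity> else 0)"
      "gamma_limsup T (\<lambda>h. indicator_inf (S h)) p =
        (if \<exists>U. openin T U \<and> p \<in> U \<and> (\<exists>\<^sub>F h in sequentially. S h \<inter> U = {}) then \<infinity> else 0)"
      by (simp_all only: gamma_liminf_def gamma_limsup_def INF_indicator_inf
          liminf_zero_infinity limsup_zero_infinity SUP_nhds Bex_def mem_Collect_eq conj_assoc)
    then show ?thesis
      by (auto simp: indicator_inf_def frequently_def)
  qed
  then show ?thesis
    unfolding kuratowski_limit_def gamma_converges_def by (intro ball_cong) auto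
qed

section \<open>Neighbourhoods absorb small displacements\<close>

text \<open>
  The property below passes to finite intersections, where the smaller radius is used, and to
  unions; so it may be checked on a subbasis. The relation \<open>R \<delta>\<close> stands for
  ``displaced by less than \<open>\<delta>\<close>''.
\<close>
lemma generated_topology_absorbs:
  fixes \<B> :: "'a set set" and R :: "real \<Rightarrow> 'a \<Rightarrow> 'a \<Rightarrow> bool"
  defines "T \<equiv> topology_generated_by \<B>"
  assumes U: "openin T U" "p \<in> U"
    and mono: "\<And>\<delta> \<epsilon> x y. R \<delta> x y \<Longrightarrow> \<delta> \<le> \<epsilon> \<Longrightarrow> R \<epsilon> x y"
    and subbasis: "\<And>B p. B \<in> \<B> \<Longrightarrow> p \<in> B \<Longrightarrow>
      \<exists>V \<delta>. openin T V \<and> p \<in> V \<and> 0 < \<delta> \<and> (\<forall>x\<in>V. \<forall>y. R \<delta> x y \<longrightarrow> y \<in> B)"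
  obtains V \<delta> where "openin T V" "p \<in> V" "0 < \<delta>" "\<And>x y. x \<in> V \<Longrightarrow> R \<delta> x y \<Longrightarrow> y \<in> U"
proof -
  from U(1) have "generate_topology_on \<B> U"
    by (simp add: T_def openin_topology_generated_by_iff)
  then have "\<exists>V \<delta>. openin T V \<and> p \<in> V \<and> 0 < \<delta> \<and> (\<forall>x\<in>V. \<forall>y. R \<delta> x y \<longrightarrow> y \<in> U)"
    using U(2)
  proof (induction arbitrary: p)
    case Empty
    then show ?case by simp
  next
    case (Int A B)
    then obtain V \<delta> W \<epsilon> where
      "openin T V" "p \<in> V" "0 < \<delta>" "\<forall>x\<in>V. \<forall>y. R \<delta> x y \<longrightarrow> y \<in> A"
      "openin T W" "p \<in> W" "0 < \<epsilon>" "\<forall>x\<in>W. \<forall>y. R \<epsilon> x y \<longrightarrow> y \<in> B"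
      by (metis IntE)
    then show ?case
      by (intro exI[of _ "V \<inter> W"] exI[of _ "min \<delta> \<epsilon>"])
        (auto dest: mono[of "min \<delta> \<epsilon>" _ _ \<delta>] mono[of "min \<delta> \<epsilon>" _ _ \<epsilon>])
  next
    case (UN K)
    then obtain A where A: "A \<in> K" "p \<in> A" by blast
    with UN.IH[of A p] obtain V \<delta> where
      "openin T V" "p \<in> V" "0 < \<delta>" "\<forall>x\<in>V. \<forall>y. R \<delta> x y \<longrightarrow> y \<in> A"
      by blast
    with A show ?case by (intro exI[of _ V] exI[of _ \<delta>]) blast
  next
    case (Basis B)
    then show ?case by (rule subbasis)
  qed
  then show thesis using that by blast
qed

text \<open>
  A subbasic weak neighbourhood of \<open>x\<close> contains the preimage of a ball around \<open>f x\<close> under a bounded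
  functional \<open>f\<close>. The preimage of a smaller ball absorbs displacements since \<open>f\<close> is uniformly
  continuous in the norm.
\<close>
lemma weak_topology_absorbs_shifts:
  fixes x :: "'z::real_normed_vector"
  assumes "openin weak_topology A" "x \<in> A"
  obtains V \<delta> where "openin weak_topology V" "x \<in> V" "0 < \<delta>"
    "\<And>u v. u \<in> V \<Longrightarrow> dist u v < \<delta> \<Longrightarrow> v \<in> A"
proof (rule generated_topology_absorbs[
      where \<B> = "{blinfun_apply f -` U | (f :: 'z \<Rightarrow>\<^sub>L real) U. open U}"
        and R = "\<lambda>\<delta> u v. dist u v < \<delta>" and U = A and p = x, folded weak_topology_def])
  fix B :: "'z set" and p
  assume "B \<in> {blinfun_apply f -` U | (f :: 'z \<Rightarrow>\<^sub>L real) U. open U}" and p: "p \<in> B"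
  then obtain f :: "'z \<Rightarrow>\<^sub>L real" and U where B: "B = blinfun_apply f -` U" and "open U"
    by blast
  with p obtain e where e: "0 < e" "ball (f p) e \<subseteq> U"
    by (auto elim: openE)
  have "uniformly_continuous_on UNIV (blinfun_apply f)"
    by (intro bounded_linear.uniformly_continuous_on[OF blinfun.bounded_linear_right]
        uniformly_continuous_on_id)
  with \<open>0 < e\<close> obtain \<delta> where \<delta>: "0 < \<delta>" "\<And>u v. dist u v < \<delta> \<Longrightarrow> dist (f u) (f v) < e / 2"
    unfolding uniformly_continuous_on_def by (metis UNIV_I dist_commute half_gt_zero)
  let ?V = "blinfun_apply f -` ball (f p) (e / 2)"
  have "openin weak_topology ?V"
    unfolding weak_topology_def by (rule topology_generated_by_Basis) blast
  moreover have "v \<in> B" if "u \<in> ?V" "dist u v < \<delta>" for u v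
  proof -
    from that have "dist (f p) (f u) < e / 2" "dist (f u) (f v) < e / 2"
      using \<delta>(2) by auto
    then have "dist (f p) (f v) < e"
      using dist_triangle[of "f p" "f v" "f u"] by linarith
    with e B show ?thesis by auto
  qed
  ultimately show "\<exists>V \<delta>. openin weak_topology V \<and> p \<in> V \<and> 0 < \<delta> \<and>
      (\<forall>x\<in>V. \<forall>y. dist x y < \<delta> \<longrightarrow> y \<in> B)"
    using e(1) \<delta>(1) by (intro exI[of _ ?V] exI[of _ \<delta>]) auto
qed (use assms that in auto)

text \<open>
  On a subbasic set the weak constraint on the first component and the strong constraint on the
  difference both leave room for a displacement of the first component.
\<close>
lemma data_topology_absorbs_shifts:
  fixes p :: "'z::real_normed_vector \<times> 'z"
  assumes "openin data_topology U" "p \<in> U"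
  obtains V \<delta> where "openin data_topology V" "p \<in> V" "0 < \<delta>"
    "\<And>y y' z. (y, z) \<in> V \<Longrightarrow> dist y y' < \<delta> \<Longrightarrow> (y', z) \<in> U"
proof (rule generated_topology_absorbs[
      where \<B> = "{(A \<times> A') \<inter> {(z, z'). z - z' \<in> C} | (A :: 'z set) A' C.
          openin weak_topology A \<and> openin weak_topology A' \<and> open C}"
        and R = "\<lambda>\<delta> q r. snd q = snd r \<and> dist (fst q) (fst r) < \<delta>" and U = U and p = p,
        folded data_topology_def])
  fix B and q :: "'z \<times> 'z"
  assume "B \<in> {(A \<times> A') \<inter> {(z, z'). z - z' \<in> C} | (A :: 'z set) A' C.
      openin weak_topology A \<and> openin weak_topology A' \<and> open C}" and q: "q \<in> B"
  then obtain A A' C where B: "B = (A \<times> A') \<inter> {(z, z'). z - z' \<in> C}"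
    and A: "openin weak_topology A" and A': "openin weak_topology A'" and C: "open C"
    by blast
  obtain y z where yz: "q = (y, z)" by (cases q)
  with q B have "y \<in> A" "z \<in> A'" "y - z \<in> C" by auto
  obtain V \<delta> where V: "openin weak_topology V" "y \<in> V" "0 < \<delta>"
    "\<And>u v. u \<in> V \<Longrightarrow> dist u v < \<delta> \<Longrightarrow> v \<in> A"
    using weak_topology_absorbs_shifts[OF A \<open>y \<in> A\<close>] by blast
  obtain e where e: "0 < e" "ball (y - z) e \<subseteq> C"
    using C \<open>y - z \<in> C\<close> by (auto elim: openE)
  let ?W = "(V \<times> A') \<inter> {(u, w). u - w \<in> ball (y - z) (e / 2)}"
  have "openin data_topology ?W"
    unfolding data_topology_def
    by (rule topology_generated_by_Basis) (use V(1) A' open_ball in blast)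
  moreover have "(v, w) \<in> B" if "(u, w) \<in> ?W" "dist u v < min \<delta> (e / 2)" for u v w
  proof -
    from that have "dist (y - z) (u - w) < e / 2" "dist (u - w) (v - w) < e / 2"
      by (auto simp: dist_norm)
    then have "dist (y - z) (v - w) < e"
      using dist_triangle[of "y - z" "v - w" "u - w"] by linarith
    with e(2) have "v - w \<in> C" by auto
    with that V(4) B show ?thesis by auto
  qed
  ultimately show "\<exists>V \<delta>. openin data_topology V \<and> q \<in> V \<and> 0 < \<delta> \<and>
      (\<forall>x\<in>V. \<forall>y. snd x = snd y \<and> dist (fst x) (fst y) < \<delta> \<longrightarrow> y \<in> B)"
    using e(1) V(2,3) \<open>z \<in> A'\<close> yz
    by (intro exI[of _ ?W] exI[of _ "min \<delta> (e / 2)"]) auto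
qed (use assms that in auto)

section \<open>Convergence of the approximating data sets\<close>

lemma dist_to_set_less_obtains:
  assumes "dist_to_set x A < ereal r"
  obtains a where "a \<in> A" "dist x a < r"
  using assms by (auto simp: dist_to_set_def INF_less_iff dist_norm)

theorem theorem3p3:
  fixes E D Dbar :: "'z::banach set" and Dh :: "nat \<Rightarrow> 'z set"
  assumes reflexive: "reflexive_space TYPE('z)"
    and separable: "separable_space (euclidean :: 'z topology)"
    and E_closed: "weakly_sequentially_closed E"
    and data_convergence: "kuratowski_limit data_topology (\<lambda>h. D \<times> E) (Dbar \<times> E)"
    and fine_approximation:
      "\<exists>\<rho> :: nat \<Rightarrow> real. decseq \<rho> \<and> \<rho> \<longlonglongrightarrow> 0 \<and>
         (\<forall>h. \<forall>\<xi>\<in>D. dist_to_set \<xi> (Dh h) < ereal (\<rho> h))"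
    and uniform_approximation:
      "\<exists>t :: nat \<Rightarrow> real. decseq t \<and> t \<longlonglongrightarrow> 0 \<and>
         (\<forall>h. \<forall>\<xi>\<in>Dh h. dist_to_set \<xi> D < ereal (t h))"
    and transversality:
      "\<exists>c b :: real. c > 0 \<and> b \<ge> 0 \<and>
         (\<forall>y\<in>D. \<forall>z\<in>E. norm (y - z) \<ge> c * (norm y + norm z) - b)"
  shows "kuratowski_limit data_topology (\<lambda>h. Dh h \<times> E) (Dbar \<times> E)"
proof -
  from fine_approximation obtain \<rho> where \<rho>: "\<rho> \<longlonglongrightarrow> 0"
    "\<And>h \<xi>. \<xi> \<in> D \<Longrightarrow> dist_to_set \<xi> (Dh h) < ereal (\<rho> h)"
    by blast
  from uniform_approximation obtain t where t: "t \<longlonglongrightarrow> 0"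
    "\<And>h \<xi>. \<xi> \<in> Dh h \<Longrightarrow> dist_to_set \<xi> D < ereal (t h)"
    by blast
  have limit_iff: "p \<in> Dbar \<times> E \<longleftrightarrow>
      (\<forall>U. openin data_topology U \<and> p \<in> U \<longrightarrow> (D \<times> E) \<inter> U \<noteq> {})" for p
    using data_convergence 
    by (simp add: kuratowski_limit_iff_meets del: split_paired_All)
  have from_D: "\<forall>\<^sub>F h in sequentially. (Dh h \<times> E) \<inter> U \<noteq> {}"
    if U: "openin data_topology U" "p \<in> U"
      and meets: "\<And>V. openin data_topology V \<Longrightarrow> p \<in> V \<Longrightarrow> (D \<times> E) \<inter> V \<noteq> {}" for U p
  proof -
    obtain V \<delta> where V: "openin data_topology V" "p \<in> V" "0 < \<delta>"
      "\<And>y y' z. (y, z) \<in> V \<Longrightarrow> dist y y' < \<delta> \<Longrightarrow> (y', z) \<in> U"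
      using data_topology_absorbs_shifts[OF U] by blast
    from meets[OF V(1,2)] obtain y z where yz: "y \<in> D" "z \<in> E" "(y, z) \<in> V" by blast
    from order_tendstoD(2)[OF \<rho>(1) V(3)] show ?thesis
    proof (rule eventually_mono)
      fix h
      assume "\<rho> h < \<delta>"
      obtain y' where "y' \<in> Dh h" "dist y y' < \<rho> h"
        using dist_to_set_less_obtains[OF \<rho>(2)[OF yz(1)]] by blast
      with \<open>\<rho> h < \<delta>\<close> V(4)[OF yz(3)] yz(2) show "(Dh h \<times> E) \<inter> U \<noteq> {}" by force
    qed
  qed
  have to_D: "(D \<times> E) \<inter> U \<noteq> {}"
    if U: "openin data_topology U" "p \<in> U"
      and meets: "\<And>V. openin data_topology V \<Longrightarrow> p \<in> V \<Longrightarrow>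
        \<exists>\<^sub>F h in sequentially. (Dh h \<times> E) \<inter> V \<noteq> {}" for U p
  proof -
    obtain V \<delta> where V: "openin data_topology V" "p \<in> V" "0 < \<delta>"
      "\<And>y y' z. (y, z) \<in> V \<Longrightarrow> dist y y' < \<delta> \<Longrightarrow> (y', z) \<in> U"
      using data_topology_absorbs_shifts[OF U] by blast
    have "\<exists>\<^sub>F h in sequentially. (Dh h \<times> E) \<inter> V \<noteq> {} \<and> t h < \<delta>"
      using meets[OF V(1,2)] order_tendstoD(2)[OF t(1) V(3)]
      by (rule frequently_eventually_frequently)
    from frequently_ex[OF this] obtain h where "(Dh h \<times> E) \<inter> V \<noteq> {}" "t h < \<delta>"
      by blast
    then obtain y z where yz: "y \<in> Dh h" "z \<in> E" "(y, z) \<in> V" by blast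
    obtain y' where "y' \<in> D" "dist y y' < t h"
      using dist_to_set_less_obtains[OF t(2)[OF yz(1)]] by blast
    with \<open>t h < \<delta>\<close> V(4)[OF yz(3)] yz(2) show ?thesis by force
  qed
  show ?thesis
    unfolding kuratowski_limit_iff_meets
  proof (intro ballI)
    fix p
    let ?met = "\<lambda>F. \<forall>U. openin data_topology U \<and> p \<in> U \<longrightarrow> F (\<lambda>h. (Dh h \<times> E) \<inter> U \<noteq> {})"
    have "?met (\<lambda>P. eventually P sequentially)" if "p \<in> Dbar \<times> E"
      using that from_D[of _ p] unfolding limit_iff by blast
    moreover have "?met (\<lambda>P. frequently P sequentially)"
      if "?met (\<lambda>P. eventually P sequentially)"
      using that eventually_frequently[OF sequentially_bot] by blast
    moreover have "p \<in> Dbar \<times> E" if "?met (\<lambda>P. frequently P sequentially)"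
      using that to_D[of _ p] unfolding limit_iff by blast
    ultimately show "(p \<in> Dbar \<times> E \<longleftrightarrow> ?met (\<lambda>P. frequently P sequentially)) \<and>
        (p \<in> Dbar \<times> E \<longleftrightarrow> ?met (\<lambda>P. eventually P sequentially))"
      by argo
  qed
qed

end
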